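(* Let $\lambda=a/b$ and $\delta=r/s$ be rational numbers ($a,b,r,s$ positive integers) with $0<\lambda<1$ and $0<\delta<1$. Let $\gamma=\frac{1+\sqrt5}{2}$ denote the golden ratio and assume that $b>a^{\gamma}$. Then the rotation number $\rho_{\lambda,\delta}$ of the contracted rotation $f_{\lambda,\delta}$ is a rational number $p/q$, where $p,q$ are integers with $$0\le p<q\le \gamma^{\,2+\frac{\gamma\log(sb)}{\log b-\gamma\log a}}.$$
   Context: For $x\in\mathbb{R}$, $[x]$ denotes the integer part (floor) and $\{x\}=x-[x]$ the fractional part. Let $I=[0,1)$. For $0<\lambda<1$ and $\delta\in I$, the contracted rotation is the map $f_{\lambda,\delta}:I\to I$, $f_{\lambda,\delta}(x)=\{\lambda x+\delta\}$. Its lift is $F_{\lambda,\delta}:\mathbb{R}\to\mathbb{R}$, $F_{\lambda,\delta}(x)=\lambda\{x\}+\delta+[x]$. The rotation number of $f_{\lambda,\delta}$ is $$\rho_{\lambda,\delta}=\lim_{k\to\infty}\frac{F_{\lambda,\delta}^k(x_0)}{k},$$ where $F_{\lambda,\delta}^k$ is the $k$-th iterate; it is known that the limit exists, does not depend on $x_0\in\mathbb{R}$, and satisfies $0\le\rho_{\lambda,\delta}<1$. *)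

theory Defs
  imports "HOL-Analysis.Analysis"
begin

definition golden_ratio :: real where
  "golden_ratio = (1 + sqrt 5) / 2"

text \<open>The map is meant on the interval \<open>{0..<1}\<close>; \<open>frac x\<close> is \<open>x - \<lfloor>x\<rfloor>\<close>.\<close>

definition contracted_rotation :: "real \<Rightarrow> real \<Rightarrow> real \<Rightarrow> real" where
  "contracted_rotation lam \<delta> x = frac (lam * x + \<delta>)"

definition contracted_rotation_lift :: "real \<Rightarrow> real \<Rightarrow> real \<Rightarrow> real" where
  "contracted_rotation_lift lam \<delta> x = lam * frac x + \<delta> + of_int \<lfloor>x\<rfloor>"

text \<open>The common limit of the averages over all starting points. It exists and is unique for the
  parameters considered here: see \<open>rotation_number_tendsto\<close> below.\<close>

definition rotation_number :: "real \<Rightarrow> real \<Rightarrow> real" where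
  "rotation_number lam \<delta> =
     (THE \<rho>. \<forall>x\<^sub>0. (\<lambda>k. (contracted_rotation_lift lam \<delta> ^^ k) x\<^sub>0 / real k) \<longlonglongrightarrow> \<rho>)"

lemma frac_contracted_rotation_lift:
  "frac (contracted_rotation_lift lam \<delta> x) = contracted_rotation lam \<delta> (frac x)"
  by (simp add: contracted_rotation_def contracted_rotation_lift_def frac_def)

lemma contracted_rotation_lift_add_int:
  "contracted_rotation_lift lam \<delta> (x + of_int n) = contracted_rotation_lift lam \<delta> x + of_int n"
  by (simp add: contracted_rotation_lift_def frac_def)

lemma contracted_rotation_lift_mono:
  assumes "0 \<le> lam" "lam \<le> 1"
  shows "mono (contracted_rotation_lift lam \<delta>)"
proof
  fix x y :: real
  assume xy: "x \<le> y"
  show "contracted_rotation_lift lam \<delta> x \<le> contracted_rotation_lift lam \<delta> y"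
  proof (cases "\<lfloor>x\<rfloor> = \<lfloor>y\<rfloor>")
    case True
    then show ?thesis
      using xy assms by (auto simp: contracted_rotation_lift_def frac_def intro!: mult_left_mono)
  next
    case False
    then have "\<lfloor>x\<rfloor> + 1 \<le> \<lfloor>y\<rfloor>"
      using floor_mono[OF xy] by linarith
    then have fl: "real_of_int \<lfloor>x\<rfloor> + 1 \<le> real_of_int \<lfloor>y\<rfloor>"
      by linarith
    have "lam * frac x \<le> 1 * 1"
      using assms by (intro mult_mono) (auto simp: less_imp_le[OF frac_lt_1])
    moreover have "0 \<le> lam * frac y"
      using assms by simp
    ultimately show ?thesis
      using fl unfolding contracted_rotation_lift_def by linarith
  qed
qed

lemma funpow_contracted_rotation_lift_add_int:
  "(contracted_rotation_lift lam \<delta> ^^ k) (x + of_int n) =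
     (contracted_rotation_lift lam \<delta> ^^ k) x + of_int n"
  by (induction k) (simp_all add: contracted_rotation_lift_add_int)

lemma funpow_contracted_rotation_lift_bound:
  assumes "0 \<le> lam" "lam \<le> 1"
  shows "\<bar>(contracted_rotation_lift lam \<delta> ^^ k) x - x - (contracted_rotation_lift lam \<delta> ^^ k) 0\<bar> \<le> 1"
proof -
  let ?G = "contracted_rotation_lift lam \<delta> ^^ k"
  have m: "mono ?G"
    using contracted_rotation_lift_mono[OF assms] by (rule mono_pow)
  have "?G 0 \<le> ?G (frac x)" "?G (frac x) \<le> ?G (0 + of_int 1)"
    using frac_lt_1[of x] by (auto intro!: monoD[OF m])
  moreover have "?G (0 + of_int 1) = ?G 0 + of_int 1"
    by (rule funpow_contracted_rotation_lift_add_int)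
  moreover have "?G x = ?G (frac x) + of_int \<lfloor>x\<rfloor>"
    using funpow_contracted_rotation_lift_add_int[where k = k and lam = lam and \<delta> = \<delta>
      and x = "frac x" and n = "\<lfloor>x\<rfloor>"]
    by (simp add: frac_def)
  moreover have "frac x = x - of_int \<lfloor>x\<rfloor>"
    by (simp add: frac_def)
  ultimately show ?thesis
    by linarith
qed

lemma funpow_contracted_rotation_lift_convergent:
  assumes "0 \<le> lam" "lam \<le> 1"
  shows "convergent (\<lambda>k. (contracted_rotation_lift lam \<delta> ^^ k) 0 / real k)"
proof -
  define a where "a k = (contracted_rotation_lift lam \<delta> ^^ k) 0" for k
  have add: "\<bar>a (m + n) - a n - a m\<bar> \<le> 1" for m n
    using funpow_contracted_rotation_lift_bound[OF assms, where \<delta> = \<delta> and k = m and x = "a n"]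
    by (simp add: a_def funpow_add)
  have mult: "\<bar>a (m * n) - real m * a n\<bar> \<le> real m" for m n
  proof (induction m)
    case 0
    then show ?case by (simp add: a_def)
  next
    case (Suc m)
    then show ?case
      using add[of n "m * n"] by (simp add: algebra_simps abs_le_iff)
  qed
  have diff: "\<bar>a m / real m - a n / real n\<bar> \<le> 1 / real m + 1 / real n" if "m > 0" "n > 0" for m n
  proof -
    have "\<bar>real n * a m - real m * a n\<bar> \<le> real m + real n"
      using mult[of m n] mult[of n m] by (simp add: mult.commute abs_le_iff)
    moreover have "a m / real m - a n / real n = (real n * a m - real m * a n) / (real m * real n)"
      using that by (simp add: field_simps)
    moreover have "1 / real m + 1 / real n = (real m + real n) / (real m * real n)"
      using that by (simp add: field_simps)
    ultimately show ?thesis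
      using that by (simp add: abs_mult divide_right_mono)
  qed
  have "Cauchy (\<lambda>k. a k / real k)"
  proof (rule metric_CauchyI)
    fix e :: real
    assume "e > 0"
    then obtain M :: nat where M: "2 / e < real M"
      using reals_Archimedean2 by blast
    have "dist (a m / real m) (a n / real n) < e" if "M \<le> m" "M \<le> n" for m n
    proof -
      have "0 < 2 / e"
        using \<open>e > 0\<close> by simp
      then have pos: "0 < real m" "0 < real n" "2 / e < real m" "2 / e < real n"
        using M that by linarith+
      then have "1 / real m < e / 2" "1 / real n < e / 2"
        using \<open>e > 0\<close> by (simp_all add: field_simps)
      then show ?thesis
        using diff[of m n] pos by (simp add: dist_real_def)
    qed
    then show "\<exists>M. \<forall>m\<ge>M. \<forall>n\<ge>M. dist (a m / real m) (a n / real n) < e"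
      by blast
  qed
  then show ?thesis
    unfolding a_def by (rule Cauchy_convergent)
qed

lemma rotation_number_tendsto:
  assumes "0 < lam" "lam < 1"
  shows "(\<lambda>k. (contracted_rotation_lift lam \<delta> ^^ k) x\<^sub>0 / real k) \<longlonglongrightarrow> rotation_number lam \<delta>"
proof -
  let ?G = "\<lambda>k. contracted_rotation_lift lam \<delta> ^^ k"
  have l: "0 \<le> lam" "lam \<le> 1"
    using assms by auto
  obtain \<rho> where \<rho>: "(\<lambda>k. ?G k 0 / real k) \<longlonglongrightarrow> \<rho>"
    using funpow_contracted_rotation_lift_convergent[OF l] by (auto simp: convergent_def)
  have all: "\<forall>x. (\<lambda>k. ?G k x / real k) \<longlonglongrightarrow> \<rho>"
  proof
    fix x
    have lim: "(\<lambda>k. (\<bar>x\<bar> + 1) / real k) \<longlonglongrightarrow> 0"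
      by (rule lim_const_over_n)
    have "norm (?G k x / real k - ?G k 0 / real k) \<le> (\<bar>x\<bar> + 1) / real k" for k
    proof -
      have "\<bar>?G k x - ?G k 0\<bar> \<le> \<bar>x\<bar> + 1"
        using funpow_contracted_rotation_lift_bound[OF l, where \<delta> = \<delta> and k = k and x = x] by linarith
      then show ?thesis
        by (simp add: diff_divide_distrib[symmetric] divide_right_mono)
    qed
    then have "\<forall>\<^sub>F k in sequentially. norm (?G k x / real k - ?G k 0 / real k) \<le> (\<bar>x\<bar> + 1) / real k"
      by (intro always_eventually allI)
    from Lim_null_comparison[OF this lim]
    have "(\<lambda>k. ?G k x / real k - ?G k 0 / real k) \<longlonglongrightarrow> 0" .
    from tendsto_add[OF this \<rho>] show "(\<lambda>k. ?G k x / real k) \<longlonglongrightarrow> \<rho>"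
      by simp
  qed
  have rot: "rotation_number lam \<delta> = \<rho>"
    unfolding rotation_number_def
  proof (rule the_equality[where P = "\<lambda>z. \<forall>x. (\<lambda>k. ?G k x / real k) \<longlonglongrightarrow> z", OF all])
    fix z
    assume "\<forall>x. (\<lambda>k. ?G k x / real k) \<longlonglongrightarrow> z"
    then have "(\<lambda>k. ?G k 0 / real k) \<longlonglongrightarrow> z" by (rule spec)
    then show "z = \<rho>" using \<rho> by (rule LIMSEQ_unique)
  qed
  show ?thesis
    unfolding rot using all by (rule spec)
qed

end

theory Submission
  imports Defs
begin

text \<open>For fixed \<open>\<lambda>\<close> the parameters \<open>\<delta>\<close> with a given rational rotation number \<open>p/q\<close> form an interval
  whose endpoints are given by Hecke--Mahler series, here \<open>plateau_left\<close> and \<open>plateau_right\<close>. For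
  \<open>\<lambda> = a/b\<close> these endpoints are rationals with denominator dividing \<open>b (b^q - a^q)\<close>, while the gap
  between the intervals of two Farey neighbours \<open>p/q < p'/q'\<close> is at most \<open>\<lambda>^(q + q' - 1)\<close>. If the
  rational \<open>\<delta> = r/s\<close> lies in that gap, its distance to an endpoint is at least
  \<open>1 / (s b (b^q - a^q))\<close>, which yields \<open>b^max(q, q') \<le> s b^2 a^(q + q' - 1)\<close>. For
  \<open>b > a^\<gamma>\<close> and a ratio of \<open>q\<close> and \<open>q'\<close> of at least the golden ratio \<open>\<gamma>\<close> this bounds the
  larger denominator. Descending the Stern--Brocot tree, such a ratio occurs at least at every
  second step, so the descent stops at a mediant of denominator at most
  \<open>\<gamma>^2 log (s b^2) / (log b - \<gamma> log a)\<close>.\<close>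

section \<open>Plateau endpoints and summability\<close>

definition plateau_left :: "real \<Rightarrow> real \<Rightarrow> real" where
  "plateau_left lam \<alpha> = (1 - lam)^2 * (\<Sum>j. lam ^ j * of_int \<lceil>real (Suc j) * \<alpha>\<rceil>)"

text \<open>The terms differ from those of \<open>plateau_left\<close> exactly where
  \<open>real (Suc j) * \<alpha>\<close> is an integer, and there they are larger by one. So for
  irrational \<alpha> the two endpoints coincide, while at a fraction they bound a proper
  interval.\<close>

definition plateau_right :: "real \<Rightarrow> real \<Rightarrow> real" where
  "plateau_right lam \<alpha> = (1 - lam)^2 * (\<Sum>j. lam ^ j * of_int (\<lfloor>real (Suc j) * \<alpha>\<rfloor> + 1))"

lemma summable_power_mult_linear_bound:
  fixes lam :: real and c :: "nat \<Rightarrow> real"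
  assumes "0 < lam" "lam < 1" and c: "\<And>j. \<bar>c j\<bar> \<le> C * real (Suc j)"
  shows "summable (\<lambda>j. lam ^ j * c j)"
proof (rule summable_comparison_test')
  show "summable (\<lambda>j. C * (of_nat (Suc j) * lam ^ j))"
    using geometric_deriv_sums[of lam] assms
    by (intro summable_mult) (auto simp: sums_iff)
  show "norm (lam ^ j * c j) \<le> C * (of_nat (Suc j) * lam ^ j)" if "0 \<le> j" for j
  proof -
    have "norm (lam ^ j * c j) = lam ^ j * \<bar>c j\<bar>"
      using assms by (simp add: abs_mult)
    also have "\<dots> \<le> lam ^ j * (C * real (Suc j))"
      using assms by (intro mult_left_mono c) auto
    finally show ?thesis
      by (simp add: mult_ac)
  qed
qed

text \<open>Turns bounded deviation from a linear function of the past time \<open>m - Suc j\<close>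
  into linear growth in \<open>Suc j\<close>; the constant may depend on \<open>m\<close>, which is
  fixed in each series.\<close>

lemma abs_le_linear_bound:
  fixes x \<alpha> :: real
  assumes "\<bar>x - (real m - real (Suc j)) * \<alpha>\<bar> \<le> 2"
  shows "\<bar>x\<bar> \<le> (2 + (real m + 1) * \<bar>\<alpha>\<bar>) * real (Suc j)"
proof -
  have "\<bar>x\<bar> \<le> 2 + \<bar>(real m - real (Suc j)) * \<alpha>\<bar>"
    using assms by linarith
  also have "\<dots> = 2 + \<bar>real m - real (Suc j)\<bar> * \<bar>\<alpha>\<bar>"
    by (simp add: abs_mult)
  also have "\<bar>real m - real (Suc j)\<bar> \<le> (real m + 1) * real (Suc j)"
    by (simp add: algebra_simps abs_le_iff)
  also have "2 + (real m + 1) * real (Suc j) * \<bar>\<alpha>\<bar> \<le> (2 + (real m + 1) * \<bar>\<alpha>\<bar>) * real (Suc j)"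
    by (simp add: algebra_simps)
  finally show ?thesis
    by (simp add: mult_right_mono)
qed

lemma summable_power_mult_approx_linear:
  fixes lam \<alpha> :: real
  assumes "0 < lam" "lam < 1"
    and "\<And>j. \<bar>c j - (real m - real (Suc j)) * \<alpha>\<bar> \<le> 2"
  shows "summable (\<lambda>j. lam ^ j * c j)"
  using assms(1,2) abs_le_linear_bound[OF assms(3)] by (rule summable_power_mult_linear_bound)

lemma summable_power_mult_approx_linear_Suc:
  fixes lam \<alpha> :: real
  assumes "0 < lam" "lam < 1"
    and "\<And>j. \<bar>c j - real (Suc j) * \<alpha>\<bar> \<le> 2"
  shows "summable (\<lambda>j. lam ^ j * c j)"
proof (rule summable_power_mult_approx_linear[where m = 0 and \<alpha> = "-\<alpha>"])
  show "\<bar>c j - (real 0 - real (Suc j)) * (-\<alpha>)\<bar> \<le> 2" for j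
    using assms(3)[of j] by (simp add: algebra_simps)
qed (use assms in auto)

lemma summable_plateau_left:
  "0 < lam \<Longrightarrow> lam < 1 \<Longrightarrow> summable (\<lambda>j. lam ^ j * real_of_int \<lceil>real (Suc j) * \<alpha>\<rceil>)"
  by (rule summable_power_mult_approx_linear_Suc[where \<alpha> = \<alpha>]) linarith+

lemma summable_plateau_right:
  "0 < lam \<Longrightarrow> lam < 1 \<Longrightarrow> summable (\<lambda>j. lam ^ j * real_of_int (\<lfloor>real (Suc j) * \<alpha>\<rfloor> + 1))"
  by (rule summable_power_mult_approx_linear_Suc[where \<alpha> = \<alpha>]) linarith+

section \<open>Coded orbits and bounds on the rotation number\<close>

text \<open>The orbit with itinerary \<open>n\<close>, given by its full past: the index \<open>m - Suc j\<close> runs over all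
  integers below \<open>m\<close>.\<close>

definition coded_orbit :: "real \<Rightarrow> real \<Rightarrow> (real \<Rightarrow> int) \<Rightarrow> nat \<Rightarrow> real" where
  "coded_orbit lam \<delta> n m =
     \<delta> / (1 - lam) + (1 - lam) * (\<Sum>j. lam ^ j * of_int (n (real m - real (Suc j))))"

text \<open>Splitting off the newest term of the past leaves \<open>lam\<close> times the older
  past. The recursion is that of the lift, with \<open>n (real m)\<close> in place of the floor of
  the current point, so comparing these two integers compares the coded orbit with a true
  one.\<close>

lemma coded_orbit_Suc:
  assumes "lam < 1" "summable (\<lambda>j. lam ^ j * of_int (n (real (Suc m) - real (Suc j))))"
  shows "coded_orbit lam \<delta> n (Suc m) = lam * coded_orbit lam \<delta> n m + \<delta> + (1 - lam) * of_int (n (real m))"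
proof -
  let ?S = "\<Sum>j. lam ^ j * of_int (n (real m - real (Suc j)))"
  have S: "(\<Sum>j. lam ^ j * of_int (n (real (Suc m) - real (Suc j)))) = of_int (n (real m)) + lam * ?S"
  proof -
    have s: "summable (\<lambda>j. lam ^ j * of_int (n (real m - real j)))"
      using assms(2) by simp
    then have s1: "summable (\<lambda>j. lam * (lam ^ j * of_int (n (real m - real (Suc j)))))"
      by (subst (asm) summable_Suc_iff[symmetric]) (simp add: mult_ac)
    have "(\<Sum>j. lam ^ j * of_int (n (real m - real j))) =
        of_int (n (real m)) + (\<Sum>j. lam * (lam ^ j * of_int (n (real m - real (Suc j)))))"
      using suminf_split_head[OF s] by (simp add: mult_ac)
    moreover have "(\<Sum>j. lam * (lam ^ j * of_int (n (real m - real (Suc j))))) = lam * ?S"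
    \<comment> \<open>Summability of the inner series comes from \<open>s1\<close> by cancelling
      \<open>lam\<close>; for \<open>lam = 0\<close> both sides vanish.\<close>
    proof (cases "lam = 0")
      case False
      then show ?thesis
        using s1 by (intro suminf_mult) (simp add: summable_cmult_iff)
    qed simp
    ultimately show ?thesis
      by simp
  qed
  define e where "e = \<delta> / (1 - lam)"
  have "\<delta> = (1 - lam) * e"
    using assms(1) by (simp add: e_def)
  then show ?thesis
    unfolding coded_orbit_def S e_def[symmetric] by (elim ssubst) (simp add: algebra_simps)
qed

lemma contracted_rotation_lift_floor:
  "contracted_rotation_lift lam \<delta> x = lam * x + \<delta> + (1 - lam) * of_int \<lfloor>x\<rfloor>"
  by (simp add: contracted_rotation_lift_def frac_def algebra_simps)

text \<open>The orbit coded by the floors of t \<alpha> stays at or above its code, so the lift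
  moves each of its points at least to the next one. By monotonicity the true orbit with the same
  start stays above it, hence grows at least like m \<alpha>.\<close>

lemma rotation_number_ge:
  assumes lam: "0 < lam" "lam < 1" and \<delta>: "plateau_left lam \<alpha> \<le> \<delta>"
  shows "\<alpha> \<le> rotation_number lam \<delta>"
proof -
  let ?F = "contracted_rotation_lift lam \<delta>"
  define n where "n t = \<lfloor>t * \<alpha>\<rfloor>" for t
  have sm: "summable (\<lambda>j. lam ^ j * of_int (n (real m - real (Suc j))))" for m
    unfolding n_def using lam by (intro summable_power_mult_approx_linear[where \<alpha> = \<alpha> and m = m]) linarith+
  \<comment> \<open>Superadditivity of the floor bounds the past below by \<open>n (real m)\<close>
    minus the ceilings in \<open>plateau_left\<close>; the hypothesis on \<delta> pays for exactly
    these ceilings.\<close>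
  have ge: "of_int (n (real m)) \<le> coded_orbit lam \<delta> n m" for m
  proof -
    let ?f = "\<lambda>j. lam ^ j * of_int (n (real m))" and ?g = "\<lambda>j. lam ^ j * of_int \<lceil>real (Suc j) * \<alpha>\<rceil>"
    have geo: "?f sums (1 / (1 - lam) * of_int (n (real m)))"
      using lam by (intro sums_mult2 geometric_sums) simp
    have diff: "(\<lambda>j. ?f j - ?g j) sums (1 / (1 - lam) * of_int (n (real m)) - suminf ?g)"
      by (intro sums_diff geo summable_sums summable_plateau_left lam)
    have "1 / (1 - lam) * of_int (n (real m)) - suminf ?g \<le>
        (\<Sum>j. lam ^ j * of_int (n (real m - real (Suc j))))"
    proof (rule sums_le[OF _ diff summable_sums[OF sm]])
      fix j
      have "n (real m) - \<lceil>real (Suc j) * \<alpha>\<rceil> \<le> n (real m - real (Suc j))"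
        using le_floor_add[of "real m * \<alpha>" "- (real (Suc j) * \<alpha>)"]
        by (simp add: n_def ceiling_def algebra_simps)
      then have "real_of_int (n (real m)) - of_int \<lceil>real (Suc j) * \<alpha>\<rceil> \<le> of_int (n (real m - real (Suc j)))"
        by linarith
      from mult_left_mono[OF this, of "lam ^ j"]
      show "?f j - ?g j \<le> lam ^ j * of_int (n (real m - real (Suc j)))"
        using lam by (simp add: algebra_simps)
    qed
    from mult_left_mono[OF this, of "1 - lam"]
    have "of_int (n (real m)) - (1 - lam) * suminf ?g \<le>
        (1 - lam) * (\<Sum>j. lam ^ j * of_int (n (real m - real (Suc j))))"
      using lam by (simp add: right_diff_distrib)
    moreover have "(1 - lam) * suminf ?g \<le> \<delta> / (1 - lam)"
      using \<delta> lam by (simp add: plateau_left_def pos_le_divide_eq power2_eq_square mult_ac)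
    ultimately show ?thesis
      unfolding coded_orbit_def by linarith
  qed
  have orbit: "coded_orbit lam \<delta> n m \<le> (?F ^^ m) (coded_orbit lam \<delta> n 0)" for m
  proof (induction m)
    case (Suc m)
    have "coded_orbit lam \<delta> n (Suc m) \<le> ?F (coded_orbit lam \<delta> n m)"
      unfolding coded_orbit_Suc[OF lam(2) sm] contracted_rotation_lift_floor
      using ge[of m] lam by (simp add: le_floor_iff)
    also have "\<dots> \<le> ?F ((?F ^^ m) (coded_orbit lam \<delta> n 0))"
      using lam by (intro monoD[OF contracted_rotation_lift_mono] Suc.IH) auto
    finally show ?case
      by simp
  qed simp
  have "(\<lambda>k. \<alpha> - 1 / real k) \<longlonglongrightarrow> \<alpha>"
    using tendsto_diff[OF tendsto_const lim_const_over_n[of 1]] by simp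
  moreover have "\<alpha> - 1 / real k \<le> (?F ^^ k) (coded_orbit lam \<delta> n 0) / real k" if "1 \<le> k" for k
  proof -
    have "real k * \<alpha> - 1 \<le> (?F ^^ k) (coded_orbit lam \<delta> n 0)"
      using ge[of k] orbit[of k] by (simp add: n_def) linarith
    from divide_right_mono[OF this, of "real k"] show ?thesis
      using that by (simp add: diff_divide_distrib)
  qed
  ultimately show ?thesis
    by (intro LIMSEQ_le[OF _ rotation_number_tendsto[OF lam]]) auto
qed

text \<open>Mirror image of \<open>rotation_number_ge\<close>: the code is now the largest integer
  strictly below t \<alpha>, and subadditivity of the ceiling keeps the coded orbit at most one
  above its code.\<close>

lemma rotation_number_le:
  assumes lam: "0 < lam" "lam < 1" and \<delta>: "\<delta> \<le> plateau_right lam \<alpha>"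
  shows "rotation_number lam \<delta> \<le> \<alpha>"
proof -
  let ?F = "contracted_rotation_lift lam \<delta>"
  define n where "n t = \<lceil>t * \<alpha>\<rceil> - 1" for t
  have sm: "summable (\<lambda>j. lam ^ j * of_int (n (real m - real (Suc j))))" for m
    unfolding n_def using lam by (intro summable_power_mult_approx_linear[where \<alpha> = \<alpha> and m = m]) linarith+
  have le: "coded_orbit lam \<delta> n m \<le> of_int (n (real m) + 1)" for m
  proof -
    let ?f = "\<lambda>j. lam ^ j * of_int (n (real m) + 1)"
      and ?g = "\<lambda>j. lam ^ j * of_int (\<lfloor>real (Suc j) * \<alpha>\<rfloor> + 1)"
    have geo: "?f sums (1 / (1 - lam) * of_int (n (real m) + 1))"
      using lam by (intro sums_mult2 geometric_sums) simp
    have diff: "(\<lambda>j. ?f j - ?g j) sums (1 / (1 - lam) * of_int (n (real m) + 1) - suminf ?g)"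
      by (intro sums_diff geo summable_sums summable_plateau_right lam)
    have "(\<Sum>j. lam ^ j * of_int (n (real m - real (Suc j)))) \<le>
        1 / (1 - lam) * of_int (n (real m) + 1) - suminf ?g"
    proof (rule sums_le[OF _ summable_sums[OF sm] diff])
      fix j
      have "n (real m - real (Suc j)) \<le> n (real m) + 1 - (\<lfloor>real (Suc j) * \<alpha>\<rfloor> + 1)"
        using ceiling_add_le[of "real m * \<alpha>" "- (real (Suc j) * \<alpha>)"]
        by (simp add: n_def ceiling_def algebra_simps)
      then have "real_of_int (n (real m - real (Suc j))) \<le>
          of_int (n (real m) + 1) - of_int (\<lfloor>real (Suc j) * \<alpha>\<rfloor> + 1)"
        by linarith
      from mult_left_mono[OF this, of "lam ^ j"]
      show "lam ^ j * of_int (n (real m - real (Suc j))) \<le> ?f j - ?g j"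
        by (simp only: right_diff_distrib)(use lam in simp)
    qed
    from mult_left_mono[OF this, of "1 - lam"]
    have "(1 - lam) * (\<Sum>j. lam ^ j * of_int (n (real m - real (Suc j)))) \<le>
        of_int (n (real m) + 1) - (1 - lam) * suminf ?g"
      using lam by (simp add: right_diff_distrib)
    moreover have "\<delta> / (1 - lam) \<le> (1 - lam) * suminf ?g"
      using \<delta> lam by (simp add: plateau_right_def pos_divide_le_eq power2_eq_square mult_ac)
    ultimately show ?thesis
      unfolding coded_orbit_def by linarith
  qed
  \<comment> \<open>The rotation number does not depend on the starting point, so the comparison may
    start strictly below the coded orbit.\<close>
  define x where "x = coded_orbit lam \<delta> n 0 - 1"
  \<comment> \<open>The strict inequality is what makes \<open>n\<close> bound the floor below: the coded orbit itself may
    hit a discontinuity.\<close>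
  have orbit: "(?F ^^ m) x < coded_orbit lam \<delta> n m" for m
  proof (induction m)
    case 0
    then show ?case by (simp add: x_def)
  next
    case (Suc m)
    then have "\<lfloor>(?F ^^ m) x\<rfloor> \<le> n (real m)"
      using le[of m] by (simp add: floor_le_iff)
    then have "(1 - lam) * of_int \<lfloor>(?F ^^ m) x\<rfloor> \<le> (1 - lam) * of_int (n (real m))"
      using lam by (intro mult_left_mono) auto
    moreover have "lam * (?F ^^ m) x < lam * coded_orbit lam \<delta> n m"
      using Suc lam by simp
    ultimately have "?F ((?F ^^ m) x) < coded_orbit lam \<delta> n (Suc m)"
      unfolding coded_orbit_Suc[OF lam(2) sm] contracted_rotation_lift_floor[of lam \<delta> "(?F ^^ m) x"]
      by linarith
    then show ?case
      by simp
  qed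
  have "(\<lambda>k. \<alpha> + 1 / real k) \<longlonglongrightarrow> \<alpha>"
    using tendsto_add[OF tendsto_const lim_const_over_n[of 1]] by simp
  moreover have "(?F ^^ k) x / real k \<le> \<alpha> + 1 / real k" if "1 \<le> k" for k
  proof -
    have "(?F ^^ k) x \<le> real k * \<alpha> + 1"
      using le[of k] orbit[of k] by (simp add: n_def) linarith
    from divide_right_mono[OF this, of "real k"] show ?thesis
      using that by (simp add: add_divide_distrib)
  qed
  ultimately show ?thesis
    by (intro LIMSEQ_le[OF rotation_number_tendsto[OF lam]]) auto
qed

section \<open>Arithmetic of the plateau endpoints\<close>

text \<open>Quasi-periodicity of \<open>c\<close> expresses the tail from index \<open>q\<close>
  through the whole sum S, so S solves a linear equation with factor 1 - \<lambda>^q. Multiplying by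
  b^(q+1) then clears all denominators.\<close>

lemma rational_plateau_sum:
  fixes a b q :: nat and p :: int and c :: "nat \<Rightarrow> int"
  assumes ab: "0 < a" "a < b" and per: "\<And>j. c (j + q) = c j + p"
    and sm: "summable (\<lambda>j. (real a / real b) ^ j * of_int (c j))"
  shows "\<exists>z::int. real b * (real b ^ q - real a ^ q) *
           ((1 - real a / real b)^2 * (\<Sum>j. (real a / real b) ^ j * of_int (c j))) = of_int z"
proof -
  define lam where "lam = real a / real b"
  have lam: "0 < lam" "lam < 1"
    using ab by (auto simp: lam_def)
  define S where "S = (\<Sum>j. lam ^ j * of_int (c j))"
  define P where "P = (\<Sum>j<q. lam ^ j * of_int (c j))"
  have "(\<lambda>j. lam ^ q * (lam ^ j * of_int (c j) + lam ^ j * of_int p)) sums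
      (lam ^ q * (S + 1 / (1 - lam) * of_int p))"
    using sm lam unfolding S_def lam_def[symmetric]
    by (intro sums_mult sums_add summable_sums sums_mult2 geometric_sums) auto
  then have "(\<lambda>j. lam ^ (j + q) * of_int (c (j + q))) sums (lam ^ q * (S + 1 / (1 - lam) * of_int p))"
    by (simp add: per power_add algebra_simps)
  then have "S = lam ^ q * (S + 1 / (1 - lam) * of_int p) + P"
    using suminf_split_initial_segment[OF sm, of q]
    unfolding S_def P_def lam_def[symmetric] by (simp add: sums_iff)
  then have "(1 - lam) * S = lam ^ q * ((1 - lam) * S + of_int p) + (1 - lam) * P"
    using lam by (simp add: field_simps)
  then have "(1 - lam) * ((1 - lam) * S) = (1 - lam) * (lam ^ q * ((1 - lam) * S + of_int p) + (1 - lam) * P)"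
    by simp
  then have "(1 - lam ^ q) * ((1 - lam)^2 * S) =
      (1 - lam)^2 * P + (1 - lam) * lam ^ q * of_int p"
    by (simp add: power2_eq_square algebra_simps)
  moreover have "real b * (real b ^ q - real a ^ q) = real b ^ (q + 1) * (1 - lam ^ q)"
    using ab by (simp add: lam_def power_divide field_simps)
  ultimately have "real b * (real b ^ q - real a ^ q) * ((1 - lam)^2 * S) =
      real b ^ (q + 1) * ((1 - lam)^2 * P) + real b ^ (q + 1) * (1 - lam) * lam ^ q * of_int p"
    by (simp only: mult.assoc distrib_left)
  also have "real b ^ (q + 1) * ((1 - lam)^2 * P) =
      of_int (\<Sum>j<q. (int b - int a)^2 * int b ^ (q - 1 - j) * int a ^ j * c j)"
  proof -
    have "real b ^ (q + 1) * ((1 - lam)^2 * (lam ^ j * of_int (c j))) =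
        of_int ((int b - int a)^2 * int b ^ (q - 1 - j) * int a ^ j * c j)" if "j < q" for j
    proof -
      \<comment> \<open>Two factors b clear the square of 1 - \<lambda>, j of them clear
        \<lambda>^j, and the rest remain as an integer factor.\<close>
      have "q + 1 = 2 + (q - 1 - j) + j"
        using that by simp
      then have "real b ^ (q + 1) = real b ^ 2 * real b ^ (q - 1 - j) * real b ^ j"
        by (metis power_add)
      moreover have "real b ^ j * lam ^ j = real a ^ j" "real b * (1 - lam) = real b - real a"
        using ab by (simp_all add: lam_def power_divide field_simps)
      then have "real b ^ 2 * (1 - lam)^2 = (real b - real a)^2"
        by (metis power_mult_distrib)
      ultimately show ?thesis
        using \<open>real b ^ j * lam ^ j = real a ^ j\<close>
        by (simp add: mult_ac)
    qed
    then show ?thesis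
      unfolding P_def sum_distrib_left of_int_sum by (intro sum.cong refl) (simp only: lessThan_iff)
  qed
  also have "real b ^ (q + 1) * (1 - lam) * lam ^ q * of_int p = of_int ((int b - int a) * int a ^ q * p)"
  proof -
    have "real b ^ (q + 1) * (1 - lam) * lam ^ q = (real b - real a) * real a ^ q"
      using ab by (simp add: lam_def power_divide field_simps)
    then show ?thesis
      by simp
  qed
  finally show ?thesis
    unfolding of_int_add[symmetric] S_def lam_def by (rule exI)
qed

lemma real_Suc_add_mult_fraction:
  assumes "0 < q"
  shows "real (Suc (j + q)) * (real p / real q) = real (Suc j) * (real p / real q) + of_int (int p)"
  using assms by (simp add: field_simps)

lemma plateau_left_fraction:
  assumes "0 < a" "a < b" "0 < q"
  shows "\<exists>z::int. real b * (real b ^ q - real a ^ q) *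
    plateau_left (real a / real b) (real p / real q) = of_int z"
  unfolding plateau_left_def
proof (rule rational_plateau_sum[where p = "int p"])
  show "\<lceil>real (Suc (j + q)) * (real p / real q)\<rceil> = \<lceil>real (Suc j) * (real p / real q)\<rceil> + int p" for j
    unfolding real_Suc_add_mult_fraction[OF assms(3)] by (rule ceiling_add_of_int)
  show "summable (\<lambda>j. (real a / real b) ^ j * of_int \<lceil>real (Suc j) * (real p / real q)\<rceil>)"
    using assms by (intro summable_plateau_left) auto
qed (use assms in auto)

lemma plateau_right_fraction:
  assumes "0 < a" "a < b" "0 < q"
  shows "\<exists>z::int. real b * (real b ^ q - real a ^ q) *
    plateau_right (real a / real b) (real p / real q) = of_int z"
  unfolding plateau_right_def
proof (rule rational_plateau_sum[where p = "int p"])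
  show "\<lfloor>real (Suc (j + q)) * (real p / real q)\<rfloor> + 1 = \<lfloor>real (Suc j) * (real p / real q)\<rfloor> + 1 + int p" for j
    unfolding real_Suc_add_mult_fraction[OF assms(3)] by simp
  show "summable (\<lambda>j. (real a / real b) ^ j * of_int (\<lfloor>real (Suc j) * (real p / real q)\<rfloor> + 1))"
    using assms by (intro summable_plateau_right) auto
qed (use assms in auto)

section \<open>Gap between the plateaus of Farey neighbours\<close>

text \<open>A fraction strictly between two Farey neighbours has at least the denominator of their
  mediant.\<close>

lemma farey_gap:
  fixes p q p' q' j :: nat
  assumes pos: "0 < q" "0 < q'" and farey: "p' * q = p * q' + 1" and "p' \<le> q'"
  shows "\<lceil>real j * (real p' / real q')\<rceil> - \<lfloor>real j * (real p / real q)\<rfloor> - 1 \<le> int (Suc j - (q + q'))"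
proof (induction j)
  case 0
  then show ?case by simp
next
  case (Suc j)
  let ?x = "\<lambda>j. real j * (real p / real q)" and ?y = "\<lambda>j. real j * (real p' / real q')"
  show ?case
  \<comment> \<open>For positive index the left side counts the fractions with that denominator
    strictly between the neighbours. Below the mediant's denominator there are none; from there on
    each step adds at most one, since both slopes lie in [0, 1].\<close>
  proof (cases "Suc j < q + q'")
    case True
    show ?thesis
    proof (rule ccontr)
      define m where "m = \<lfloor>?x (Suc j)\<rfloor> + 1"
      assume "\<not> ?thesis"
      then have "m \<le> \<lceil>?y (Suc j)\<rceil> - 1"
        using True by (simp add: m_def)
      then have "of_int m < ?y (Suc j)"
        by linarith
      moreover have "?x (Suc j) < of_int m"
        unfolding m_def by linarith
      ultimately have "real (Suc j) * real p < of_int m * real q" "of_int m * real q' < real (Suc j) * real p'"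
        using pos by (simp_all add: field_simps)
      then have "of_int (int (Suc j) * int p) < (of_int (m * int q) :: real)"
        "of_int (m * int q') < (of_int (int (Suc j) * int p') :: real)"
        by (simp_all del: of_nat_Suc)
      then have lt: "1 \<le> m * int q - int (Suc j) * int p" "1 \<le> int (Suc j) * int p' - m * int q'"
        unfolding of_int_less_iff by linarith+
      have "int p' * int q = int p * int q' + 1"
        using farey by (metis of_nat_mult of_nat_add of_nat_1)
      \<comment> \<open>The determinant condition makes the denominator a combination of
        \<open>q\<close> and \<open>q'\<close> whose coefficients are integers at least 1.\<close>
      then have "int (Suc j) = int q * (int (Suc j) * int p' - m * int q') + int q' * (m * int q - int (Suc j) * int p)"
        by algebra
      also have "\<dots> \<ge> int q * 1 + int q' * 1"
        using lt by (intro add_mono mult_left_mono) auto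
      finally show False
        using True by simp
    qed
  next
    case False
    have "0 \<le> real p / real q" "real p' / real q' \<le> 1"
      using assms by auto
    then have "?x j \<le> ?x (Suc j)" "?y (Suc j) \<le> ?y j + 1"
      by (auto simp: algebra_simps simp del: times_divide_eq_right)
    then have "\<lfloor>?x j\<rfloor> \<le> \<lfloor>?x (Suc j)\<rfloor>" "\<lceil>?y (Suc j)\<rceil> \<le> \<lceil>?y j\<rceil> + 1"
      by linarith+
    then show ?thesis
      using Suc False by linarith
  qed
qed

text \<open>By \<open>farey_gap\<close> the coefficient differences are at most 0 before index q +
  q' - 1 and at most 1, 2, 3, ... from there on. The shifted derivative of the geometric series sums
  this, and its denominator cancels the prefactor.\<close>

lemma plateau_gap:
  fixes p q p' q' :: nat
  assumes lam: "0 < lam" "lam < 1"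
    and pos: "0 < q" "0 < q'" and farey: "p' * q = p * q' + 1" and "p' \<le> q'"
  shows "plateau_left lam (real p' / real q') - plateau_right lam (real p / real q) \<le> lam ^ (q + q' - 1)"
proof -
  let ?l = "\<lambda>j. lam ^ j * of_int \<lceil>real (Suc j) * (real p' / real q')\<rceil>"
    and ?r = "\<lambda>j. lam ^ j * of_int (\<lfloor>real (Suc j) * (real p / real q)\<rfloor> + 1)"
  define N where "N = q + q' - 1"
  define h where "h j = lam ^ j * real (Suc (Suc j) - (q + q'))" for j
  have "(\<lambda>j. lam ^ N * (of_nat (Suc j) * lam ^ j)) sums (lam ^ N * (1 / (1 - lam)^2))"
    using lam by (intro sums_mult geometric_deriv_sums) auto
  moreover have "h (j + N) = lam ^ N * (of_nat (Suc j) * lam ^ j)" for j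
  proof -
    have "Suc (Suc (j + N)) - (q + q') = Suc j"
      using pos by (simp add: N_def)
    then show ?thesis
      unfolding h_def power_add by simp
  qed
  ultimately have "(\<lambda>j. h (j + N)) sums (lam ^ N * (1 / (1 - lam)^2))"
    by simp
  moreover have "(\<Sum>j<N. h j) = 0"
    by (intro sum.neutral) (auto simp: h_def N_def)
  ultimately have h: "h sums (lam ^ N * (1 / (1 - lam)^2))"
    by (simp add: sums_iff_shift)
  have "suminf ?l - suminf ?r \<le> lam ^ N * (1 / (1 - lam)^2)"
  proof (rule sums_le[OF _ sums_diff[OF summable_sums summable_sums] h])
    show "summable ?l" "summable ?r"
      using lam by (intro summable_plateau_left summable_plateau_right; simp)+
    fix j
    have "real_of_int (\<lceil>real (Suc j) * (real p' / real q')\<rceil> - (\<lfloor>real (Suc j) * (real p / real q)\<rfloor> + 1))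
        \<le> of_int (int (Suc (Suc j) - (q + q')))"
      unfolding of_int_le_iff using farey_gap[OF pos farey \<open>p' \<le> q'\<close>, of "Suc j"] by linarith
    from mult_left_mono[OF this, of "lam ^ j"]
    show "?l j - ?r j \<le> h j"
      using lam unfolding h_def of_int_diff right_diff_distrib of_int_of_nat_eq by simp
  qed
  from mult_left_mono[OF this, of "(1 - lam)^2"]
  show ?thesis
    using lam by (simp add: plateau_left_def plateau_right_def right_diff_distrib N_def)
qed

section \<open>Separation of rationals\<close>

text \<open>Distinct rationals differ by at least the reciprocal of the product of their
  denominators. Set against the exponentially small gap, the factor b^q from the denominator of
  \<open>v\<close> cancels and a bound on b^q' remains.\<close>

lemma power_le_of_rational_gap:
  fixes a b r s q q' :: nat and z :: int and v :: real
  assumes ab: "0 < a" "a < b" "0 < s" "0 < q"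
    and z: "real b * (real b ^ q - real a ^ q) * v = of_int z"
    and ne: "v \<noteq> real r / real s"
    and le: "\<bar>real r / real s - v\<bar> \<le> (real a / real b) ^ (q + q' - 1)"
  shows "real b ^ q' \<le> real s * real b ^ 2 * real a ^ (q + q' - 1)"
proof -
  define X where "X = real b * (real b ^ q - real a ^ q)"
  define n where "n = q + q' - 1"
  have "real a ^ q < real b ^ q"
    using ab by (intro power_strict_mono) auto
  then have X: "0 < X" "X \<le> real b * real b ^ q"
    using ab by (auto simp: X_def)
  \<comment> \<open>The integer numerator of r/s - v over the common denominator
    \<open>s * X\<close>.\<close>
  define w where "w = int r * (int b * (int b ^ q - int a ^ q)) - int s * z"
  have "of_int w = real r * X - real s * (X * v)"
    using z by (simp add: w_def X_def)
  then have w: "of_int w = real s * X * (real r / real s - v)"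
    using ab by (simp add: right_diff_distrib)
  then have "w \<noteq> 0"
    using ne X ab by auto
  then have "1 \<le> \<bar>real_of_int w\<bar>"
    by linarith
  also have "\<dots> = real s * X * \<bar>real r / real s - v\<bar>"
    unfolding w using X by (simp add: abs_mult)
  also have "\<dots> \<le> real s * (real b * real b ^ q) * (real a / real b) ^ n"
    using X le unfolding n_def by (intro mult_mono mult_left_mono) auto
  finally have "real b ^ n \<le> real b ^ n * (real s * (real b * real b ^ q) * (real a / real b) ^ n)"
    using ab by simp
  also have "\<dots> = real s * (real b * real b ^ q) * real a ^ n"
    using ab by (simp add: power_divide)
  \<comment> \<open>The extra factor b makes up for the -1 in \<open>n\<close>, so that the left
    side splits as b^q b^q'; this is where b^2 comes from.\<close>
  finally have "real b * real b ^ n \<le> real b * (real s * (real b * real b ^ q) * real a ^ n)"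
    using ab by simp
  moreover have "real b * real b ^ n = real b ^ q * real b ^ q'"
    using ab by (simp add: n_def flip: power_Suc power_add)
  ultimately have "real b ^ q * real b ^ q' \<le> real b ^ q * (real s * real b ^ 2 * real a ^ n)"
    by (simp add: power2_eq_square mult_ac)
  then show ?thesis
    using ab by (simp add: n_def)
qed

section \<open>Stern--Brocot pairs around \<delta>\<close>

definition enclosing_pair :: "real \<Rightarrow> real \<Rightarrow> nat \<Rightarrow> nat \<Rightarrow> nat \<Rightarrow> nat \<Rightarrow> bool" where
  "enclosing_pair lam \<delta> p q p' q' \<longleftrightarrow> 0 < q \<and> 0 < q' \<and> p' * q = p * q' + 1 \<and> p' \<le> q' \<and>
     plateau_right lam (real p / real q) < \<delta> \<and> \<delta> < plateau_left lam (real p' / real q')"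

text \<open>Either \<delta> lies in the plateau of the mediant, which pins the rotation number from
  both sides, or it lies left or right of that plateau, and the mediant replaces one neighbour
  without changing the determinant.\<close>

lemma enclosing_pair_mediant:
  assumes lam: "0 < lam" "lam < 1" and enc: "enclosing_pair lam \<delta> p q p' q'"
  shows "enclosing_pair lam \<delta> p q (p + p') (q + q') \<or> enclosing_pair lam \<delta> (p + p') (q + q') p' q' \<or>
    rotation_number lam \<delta> = real (p + p') / real (q + q')" "p + p' < q + q'"
proof -
  let ?m = "real (p + p') / real (q + q')"
  have "p * q' < p' * q" "p' * q \<le> q' * q"
    using enc mult_le_mono1[of p' q' q] by (simp_all add: enclosing_pair_def)
  then have "q' * p < q' * q"
    by (metis le_trans mult.commute not_less)
  then have "p < q"
    by simp
  then show "p + p' < q + q'"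
    using enc by (simp add: enclosing_pair_def)
  show "enclosing_pair lam \<delta> p q (p + p') (q + q') \<or> enclosing_pair lam \<delta> (p + p') (q + q') p' q' \<or>
    rotation_number lam \<delta> = ?m"
  proof (cases "plateau_left lam ?m \<le> \<delta> \<and> \<delta> \<le> plateau_right lam ?m")
    case True
    then show ?thesis
      using rotation_number_ge[OF lam] rotation_number_le[OF lam] by (meson order_antisym)
  next
    case False
    then show ?thesis
      using enc \<open>p < q\<close> by (auto simp: enclosing_pair_def algebra_simps)
  qed
qed

text \<open>Separating \<delta> from the endpoint belonging to one neighbour bounds the power of b
  given by the other neighbour's denominator.\<close>

lemma enclosing_pair_power_le:
  assumes ab: "0 < a" "a < b" "0 < s" and lam: "lam = real a / real b" and \<delta>: "\<delta> = real r / real s"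
    and enc: "enclosing_pair lam \<delta> p q p' q'"
  shows "real b ^ q' \<le> real s * real b ^ 2 * real a ^ (q + q' - 1)"
    and "real b ^ q \<le> real s * real b ^ 2 * real a ^ (q + q' - 1)"
proof -
  let ?l = "plateau_left lam (real p' / real q')" and ?r = "plateau_right lam (real p / real q)"
  have lam': "0 < lam" "lam < 1"
    using ab lam by auto
  have gap: "?l - ?r \<le> lam ^ (q + q' - 1)"
    using enc by (intro plateau_gap lam') (auto simp: enclosing_pair_def)
  have q: "0 < q" "0 < q'" and d: "?r < \<delta>" "\<delta> < ?l"
    using enc by (auto simp: enclosing_pair_def)
  obtain z where "real b * (real b ^ q - real a ^ q) * ?r = of_int z"
    using plateau_right_fraction[OF ab(1,2) q(1), of p] lam by auto
  from power_le_of_rational_gap[OF ab q(1) this, of r q']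
  show "real b ^ q' \<le> real s * real b ^ 2 * real a ^ (q + q' - 1)"
    using d gap unfolding lam[symmetric] \<delta>[symmetric] by linarith
  obtain z' where "real b * (real b ^ q' - real a ^ q') * ?l = of_int z'"
    using plateau_left_fraction[OF ab(1,2) q(2), of p'] lam by auto
  from power_le_of_rational_gap[OF ab q(2) this, of r q]
  show "real b ^ q \<le> real s * real b ^ 2 * real a ^ (q + q' - 1)"
    using d gap unfolding lam[symmetric] \<delta>[symmetric] by (simp add: add.commute)
qed

section \<open>Golden ratio estimates\<close>

lemma golden_ratio_square: "golden_ratio * golden_ratio = golden_ratio + 1"
  by (simp add: golden_ratio_def field_simps)

lemma golden_ratio_bounds: "161/100 < golden_ratio" "golden_ratio < 2"
proof -
  have "111/50 < sqrt 5"
    by (rule real_less_rsqrt) (simp add: power2_eq_square)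
  moreover have "sqrt 5 < 3"
    by (rule real_less_lsqrt) auto
  ultimately show "161/100 < golden_ratio" "golden_ratio < 2"
    by (simp_all add: golden_ratio_def)
qed

text \<open>If \<gamma> n \<le> M, then n + M \<le> \<gamma> M because 1 + 1/\<gamma> = \<gamma>.
  The power bound becomes b^M \<le> s b^2 a^(\<gamma> M), and logarithms isolate M.\<close>

lemma enclosing_pair_unbalanced:
  assumes ab: "0 < a" "a < b" "0 < s" and lam: "lam = real a / real b" and \<delta>: "\<delta> = real r / real s"
    and pos: "0 < ln b - golden_ratio * ln a"
    and enc: "enclosing_pair lam \<delta> p q p' q'"
  shows "golden_ratio * real q \<le> real q' \<Longrightarrow>
      real q' \<le> ln (real s * real b ^ 2) / (ln b - golden_ratio * ln a)"
    and "golden_ratio * real q' \<le> real q \<Longrightarrow>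
      real q \<le> ln (real s * real b ^ 2) / (ln b - golden_ratio * ln a)"
proof -
  have *: "real M \<le> ln (real s * real b ^ 2) / (ln b - golden_ratio * ln a)"
    if le: "real b ^ M \<le> real s * real b ^ 2 * real a ^ (n + M - 1)" and M: "golden_ratio * real n \<le> real M"
    for n M
  proof -
    have "golden_ratio * real (n + M - 1) \<le> golden_ratio * (real n + real M)"
      using golden_ratio_bounds by simp
    also have "\<dots> \<le> real M + golden_ratio * real M"
      using M by (simp add: algebra_simps)
    also have "\<dots> = golden_ratio * (golden_ratio * real M)"
      using golden_ratio_square by (simp add: algebra_simps flip: mult.assoc)
    finally have n: "real (n + M - 1) \<le> golden_ratio * real M"
      using golden_ratio_bounds by simp
    have "real M * ln b = ln (real b ^ M)"
      using ab by (simp add: ln_realpow)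
    also have "\<dots> \<le> ln (real s * real b ^ 2 * real a ^ (n + M - 1))"
      using ab le by (subst ln_le_cancel_iff) auto
    also have "\<dots> = ln (real s * real b ^ 2) + real (n + M - 1) * ln a"
      using ab by (subst ln_mult_pos) (auto simp: ln_realpow)
    also have "\<dots> \<le> ln (real s * real b ^ 2) + golden_ratio * real M * ln a"
      using ab n by (intro add_left_mono mult_right_mono) auto
    finally have "real M * (ln b - golden_ratio * ln a) \<le> ln (real s * real b ^ 2)"
      by (simp add: algebra_simps)
    then show ?thesis
      using pos by (simp add: pos_le_divide_eq)
  qed
  note le = enclosing_pair_power_le[OF ab lam \<delta> enc]
  show "real q' \<le> ln (real s * real b ^ 2) / (ln b - golden_ratio * ln a)"
    if "golden_ratio * real q \<le> real q'"
    using * le(1) that by blast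
  show "real q \<le> ln (real s * real b ^ 2) / (ln b - golden_ratio * ln a)"
    if "golden_ratio * real q' \<le> real q"
    using *[of q q'] le(2) that by (simp add: add.commute)
qed

text \<open>The constant is chosen so that 161/100 * 37/80 * 27/10 exceeds 2, as
  \<open>two_mult_le_golden_ratio_powr\<close> needs. Passing to an eighth power makes the quadratic
  bound on exp sharp enough.\<close>

lemma ln_golden_ratio_ge: "37/80 \<le> ln golden_ratio"
proof -
  have "exp (37/80 :: real) = exp (8 * (37/640))"
    by simp
  also have "\<dots> = exp (37/640) ^ 8"
    using exp_of_nat_mult[of 8 "37/640 :: real"] by simp
  also have "\<dots> \<le> (1 + 37/640 + (37/640)^2) ^ 8"
    by (intro power_mono exp_bound) auto
  also have "\<dots> < golden_ratio"
    by (rule less_trans[OF _ golden_ratio_bounds(1)]) (simp add: power_divide)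
  finally show ?thesis
    using golden_ratio_bounds by (subst ln_ge_iff) auto
qed

lemma exp_1_ge: "27/10 \<le> exp (1::real)"
proof -
  have "27/10 \<le> (1 + 1/8 + (1/8)^2 / 2 :: real) ^ 8"
    by (simp add: power_divide)
  also have "\<dots> \<le> exp (1/8) ^ 8"
    by (intro power_mono exp_lower_Taylor_quadratic) auto
  also have "\<dots> = exp 1"
    using exp_of_nat_mult[of 8 "1/8 :: real"] by simp
  finally show ?thesis .
qed

text \<open>The tangent of exp at 1 gives exp t \<ge> e t, so the claim for x \<ge> 0 reduces to e
  \<gamma> ln \<gamma> \<ge> 2. It converts a linear bound on the denominator into the exponential
  form.\<close>

lemma two_mult_le_golden_ratio_powr: "2 * x \<le> golden_ratio powr (golden_ratio * x)"
proof (cases "0 \<le> x")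
  case True
  define t where "t = golden_ratio * x * ln golden_ratio"
  have "161/100 * x * (37/80) \<le> t"
    unfolding t_def using True golden_ratio_bounds ln_golden_ratio_ge by (intro mult_mono) auto
  then have "2 * x \<le> 27/10 * t"
    using True by simp
  also have "\<dots> \<le> exp 1 * exp (t - 1)"
    using exp_1_ge exp_ge_add_one_self[of "t - 1"] True golden_ratio_bounds
    by (intro mult_mono) (auto simp: t_def)
  also have "\<dots> = golden_ratio powr (golden_ratio * x)"
    using golden_ratio_bounds by (simp add: powr_def t_def flip: exp_add)
  finally show ?thesis .
next
  case False
  then show ?thesis
    using powr_ge_zero[of golden_ratio "golden_ratio * x"] by linarith
qed

text \<open>Here x, y are the denominators of a pair and x, x + y those of a child, whose mediant
  has denominator 2x + y. Either the child has ratio at least \<gamma>, or y < x/\<gamma> and the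
  parent does; in both cases \<gamma>^2 = \<gamma> + 1 gives the bound.\<close>

lemma golden_ratio_step_le:
  assumes "0 < x" "0 < y" "0 < L"
    and "golden_ratio * x \<le> x + y \<Longrightarrow> x + y \<le> L" and "golden_ratio * y \<le> x \<Longrightarrow> x \<le> L"
  shows "x + (x + y) \<le> golden_ratio^2 * L"
proof (cases "golden_ratio * x \<le> x + y")
  case True
  have "golden_ratio * (x + (x + y)) \<le> (x + y) + golden_ratio * (x + y)"
    using True by (simp add: algebra_simps)
  also have "\<dots> = golden_ratio * (golden_ratio * (x + y))"
    using golden_ratio_square by (simp add: algebra_simps flip: mult.assoc)
  finally have "x + (x + y) \<le> golden_ratio * (x + y)"
    using golden_ratio_bounds by simp
  also have "\<dots> \<le> golden_ratio * L"
    using True assms golden_ratio_bounds by simp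
  also have "\<dots> \<le> golden_ratio^2 * L"
    using assms golden_ratio_bounds by (simp add: power2_eq_square)
  finally show ?thesis .
next
  case False
  then have "golden_ratio * (x + y) \<le> golden_ratio * (golden_ratio * x)"
    using golden_ratio_bounds by simp
  also have "\<dots> = x + golden_ratio * x"
    using golden_ratio_square by (simp add: algebra_simps flip: mult.assoc)
  finally have "x \<le> L"
    using assms by (simp add: algebra_simps)
  have "x + (x + y) \<le> (golden_ratio + 1) * x"
    using False by (simp add: algebra_simps)
  also have "\<dots> \<le> (golden_ratio + 1) * L"
    using \<open>x \<le> L\<close> golden_ratio_bounds by simp
  finally show ?thesis
    using golden_ratio_square by (simp add: power2_eq_square)
qed

section \<open>Stern--Brocot descent and the final bound\<close>

text \<open>Among the enclosing pairs whose mediant respects the bound, take one with the largest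
  mediant denominator. If a child enclosed \<delta>, its larger mediant would still respect the
  bound by \<open>golden_ratio_step_le\<close>; hence the mediant is the rotation number.\<close>

lemma rational_rotation_number_bounded:
  assumes ab: "0 < a" "a < b" "0 < s" and lam: "lam = real a / real b" and \<delta>: "\<delta> = real r / real s"
    and \<delta>': "0 < \<delta>" "\<delta> < 1"
    and pos: "0 < ln b - golden_ratio * ln a"
  shows "\<exists>p q. p < q \<and> rotation_number lam \<delta> = real p / real q \<and>
    real q \<le> golden_ratio^2 * (ln (real s * real b ^ 2) / (ln b - golden_ratio * ln a))"
proof -
  define L where "L = ln (real s * real b ^ 2) / (ln b - golden_ratio * ln a)"
  have lam': "0 < lam" "lam < 1"
    using ab lam by auto
  have g2: "golden_ratio^2 = golden_ratio + 1"
    using golden_ratio_square by (simp add: power2_eq_square)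
  \<comment> \<open>Makes the root pair 0/1, 1/1 admissible: its mediant has denominator 2.\<close>
  have "1 \<le> L"
  proof -
    have "ln b - golden_ratio * ln a \<le> ln b"
      using ab golden_ratio_bounds by simp
    also have "\<dots> \<le> ln (real s * real b ^ 2)"
    proof (subst ln_le_cancel_iff)
      have "1 * real b \<le> (real s * real b) * real b"
        using ab by (intro mult_right_mono) (auto simp flip: of_nat_mult)
      then show "real b \<le> real s * real b ^ 2"
        by (simp add: power2_eq_square)
    qed (use ab in auto)
    finally show ?thesis
      using pos by (simp add: L_def)
  qed
  then have L: "2 \<le> golden_ratio^2 * L"
    unfolding g2 using golden_ratio_bounds mult_mono[of 2 "golden_ratio + 1" 1 L] by linarith
  define P where "P n \<longleftrightarrow>
    (\<exists>p q p' q'. enclosing_pair lam \<delta> p q p' q' \<and> n = q + q' \<and> real n \<le> golden_ratio^2 * L)" for n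
  show ?thesis
  \<comment> \<open>The descent needs \<delta> right of the plateau of 0; inside that plateau the
    rotation number is 0/1.\<close>
  proof (cases "\<delta> \<le> plateau_right lam 0")
    case True
    moreover have "plateau_left lam 0 \<le> \<delta>"
      using \<delta>' by (simp add: plateau_left_def)
    ultimately have "rotation_number lam \<delta> = 0"
      using rotation_number_ge[OF lam'] rotation_number_le[OF lam'] by (meson order_antisym)
    then show ?thesis
      using L by (intro exI[of _ 0] exI[of _ 1]) (simp add: L_def)
  next
    case False
    have "(\<lambda>j. lam ^ j * of_int \<lceil>real (Suc j) * 1\<rceil>) sums (1 / (1 - lam)^2)"
      using geometric_deriv_sums[of lam] lam' by (simp add: mult_ac)
    then have "plateau_left lam 1 = 1"
      using lam' by (simp add: plateau_left_def sums_iff)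
    then have "enclosing_pair lam \<delta> 0 1 1 1"
      using False \<delta>' by (simp add: enclosing_pair_def)
    then have "P 2"
      unfolding P_def using L by (intro exI[of _ 0] exI[of _ 1] conjI) auto
    moreover have bound: "n \<le> nat \<lfloor>golden_ratio^2 * L\<rfloor>" if "P n" for n
      using that by (auto simp: P_def le_nat_floor)
    ultimately have "P (Greatest P)"
      by (rule GreatestI_nat)
    then obtain p q p' q' where enc: "enclosing_pair lam \<delta> p q p' q'"
      and N: "Greatest P = q + q'" "real (Greatest P) \<le> golden_ratio^2 * L"
      unfolding P_def by blast
    have max: "n \<le> q + q'" if "P n" for n
      using Greatest_le_nat[of P n, OF that bound] N by simp
    have qpos: "0 < q" "0 < q'"
      using enc by (auto simp: enclosing_pair_def)
    note unb = enclosing_pair_unbalanced[OF ab lam \<delta> pos, folded L_def]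
    have "\<not> enclosing_pair lam \<delta> p q (p + p') (q + q')"
    proof
      assume child: "enclosing_pair lam \<delta> p q (p + p') (q + q')"
      have "real q + (real q + real q') \<le> golden_ratio^2 * L"
        using unb(1)[OF child] unb(2)[OF enc] qpos \<open>1 \<le> L\<close>
        by (intro golden_ratio_step_le) auto
      then have "P (q + (q + q'))"
        using child unfolding P_def
        by (intro exI conjI) auto
      from max[OF this] show False
        using qpos by simp
    qed
    moreover have "\<not> enclosing_pair lam \<delta> (p + p') (q + q') p' q'"
    proof
      assume child: "enclosing_pair lam \<delta> (p + p') (q + q') p' q'"
      have "real q' + (real q' + real q) \<le> golden_ratio^2 * L"
        using unb(2)[OF child] unb(1)[OF enc] qpos \<open>1 \<le> L\<close>
        by (intro golden_ratio_step_le) (auto simp: add.commute)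
      then have "P ((q + q') + q')"
        using child unfolding P_def
        by (intro exI conjI) auto
      from max[OF this] show False
        using qpos by simp
    qed
    ultimately have "rotation_number lam \<delta> = real (p + p') / real (q + q')" "p + p' < q + q'"
      using enclosing_pair_mediant[OF lam' enc] by auto
    then show ?thesis
      using N unfolding L_def by (intro exI[of _ "p + p'"] exI[of _ "q + q'"]) simp
  qed
qed

theorem theorem2:
  fixes a b r s :: nat and lam \<delta> :: real
  assumes "0 < a" and "0 < b" and "0 < r" and "0 < s"
    and "lam = real a / real b" and "\<delta> = real r / real s"
    and "0 < lam" and "lam < 1" and "0 < \<delta>" and "\<delta> < 1"
    and "real b > real a powr golden_ratio"
  shows "\<exists>p q :: int. 0 \<le> p \<and> p < q \<and>
           real_of_int q \<le> golden_ratio powr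
             (2 + golden_ratio * ln (real s * real b) / (ln (real b) - golden_ratio * ln (real a))) \<and>
           rotation_number lam \<delta> = real_of_int p / real_of_int q"
proof -
  define D where "D = ln (real b) - golden_ratio * ln (real a)"
  define x where "x = ln (real s * real b) / D"
  have "a < b"
    using assms(2,5,8) by simp
  have "ln (real a powr golden_ratio) < ln (real b)"
    using assms(1,2,11) by (subst ln_less_cancel_iff) auto
  then have D: "0 < D"
    using assms(1) by (simp add: D_def ln_powr)
  from rational_rotation_number_bounded[OF assms(1) \<open>a < b\<close> assms(4-6,9,10) D[unfolded D_def]]
  obtain p q where pq: "p < q" "rotation_number lam \<delta> = real p / real q"
    and q: "real q \<le> golden_ratio^2 * (ln (real s * real b ^ 2) / D)"
    unfolding D_def by blast
  have "1 \<le> real s"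
    using assms(4) by simp
  \<comment> \<open>Replacing s b^2 by (s b)^2 costs a factor 2 in the logarithm, which
    \<open>two_mult_le_golden_ratio_powr\<close> absorbs.\<close>
  then have "real s * real b ^ 2 \<le> real s * (real s * real b ^ 2)"
    using mult_right_mono[of 1 "real s" "real s * real b ^ 2"] by simp
  also have "\<dots> = (real s * real b) ^ 2"
    by (simp add: power2_eq_square mult_ac)
  finally have "ln (real s * real b ^ 2) \<le> ln ((real s * real b) ^ 2)"
    using assms(2,4) by (subst ln_le_cancel_iff) auto
  also have "\<dots> = 2 * ln (real s * real b)"
    using assms(2,4) by (subst ln_realpow) auto
  finally have "ln (real s * real b ^ 2) / D \<le> 2 * x"
    using D by (simp add: x_def pos_divide_le_eq)
  also have "\<dots> \<le> golden_ratio powr (golden_ratio * x)"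
    by (rule two_mult_le_golden_ratio_powr)
  finally have "golden_ratio^2 * (ln (real s * real b ^ 2) / D) \<le>
      golden_ratio^2 * golden_ratio powr (golden_ratio * x)"
    by (intro mult_left_mono) auto
  also have "\<dots> = golden_ratio powr (2 + golden_ratio * x)"
    using golden_ratio_bounds by (simp add: powr_add)
  finally have "real q \<le> golden_ratio powr (2 + golden_ratio * ln (real s * real b) / D)"
    using q by (simp add: x_def)
  then show ?thesis
    using pq unfolding D_def by (intro exI[of _ "int p"] exI[of _ "int q"]) auto
qed

end
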